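(* Let $\mathcal{Y}$ be a Polish space, let $d$ be a metric on the set $\mathcal{P}(\mathcal{Y})$ of Borel probability measures on $\mathcal{Y}$, and let $\mathcal{A}=\{A_1,\dots,A_K\}\subset\mathcal{P}(\mathcal{Y})$ be affinely independent. Let $\mathcal{S}=\mathrm{conv}(\mathcal{A})$. Then for all $r^{(1)},r^{(2)}\in\mathcal{S}$, $$\mathrm{SWD}(r^{(1)},r^{(2)})=W(\boldsymbol{\alpha}^{(1)},\boldsymbol{\alpha}^{(2)};d),$$ where $\boldsymbol{\alpha}^{(1)},\boldsymbol{\alpha}^{(2)}$ are the mixing measures corresponding to $r^{(1)},r^{(2)}$.
   Context: $\mathrm{SWD}$ is defined, for $r^{(1)},r^{(2)}\in\mathcal{S}$, by $\mathrm{SWD}(r^{(1)},r^{(2)})=\sup_\phi \phi(r^{(1)},r^{(2)})$, the supremum being over all functions $\phi:\mathcal{S}\times\mathcal{S}\to\mathbb{R}$ such that (R1) $\phi$ is jointly convex in its two arguments, and (R2) $\phi(A_k,A_\ell)=d(A_k,A_\ell)$ for all $k,\ell\in\{1,\dots,K\}$. By affine independence each $r\in\mathcal{S}$ can be written uniquely as $r=\sum_{k=1}^K\alpha_kA_k$ with $\alpha$ in the probability simplex $\Delta_K$; its mixing measure is $\boldsymbol{\alpha}=\sum_{k=1}^K\alpha_k\delta_{A_k}$, a finitely supported probability measure on the metric space $(\mathcal{P}(\mathcal{Y}),d)$. $W(\cdot,\cdot;d)$ is the (order 1) Wasserstein distance with ground metric $d$: for $\boldsymbol\alpha=\sum_k\alpha_k\delta_{A_k}$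 and $\boldsymbol\beta=\sum_k\beta_k\delta_{A_k}$, $W(\boldsymbol\alpha,\boldsymbol\beta;d)=\inf_\gamma\sum_{k,\ell}\gamma_{k\ell}\,d(A_k,A_\ell)$, over nonnegative $K\times K$ matrices $\gamma$ with row sums $\alpha_k$ and column sums $\beta_\ell$. *)

theory Defs
  imports "HOL-Probability.Probability"
begin

text \<open>
  Measures do not form a vector space in the library, so convex combinations are written out
  setwise. Finite families \<open>A\<^sub>1, \<dots>, A\<^sub>K\<close> are functions on \<^typ>\<open>nat\<close> of which only the values on
  \<open>{1..K}\<close> matter; \<open>\<P>(\<Y>)\<close> is \<^term>\<open>space (prob_algebra borel)\<close>.
\<close>

definition mixture :: "nat \<Rightarrow> (nat \<Rightarrow> 'a::topological_space measure) \<Rightarrow> (nat \<Rightarrow> real) \<Rightarrow> 'a measure"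
  where "mixture K A \<alpha> =
    measure_of UNIV (sets borel) (\<lambda>B. \<Sum>k = 1..K. ennreal (\<alpha> k) * emeasure (A k) B)"

definition mix :: "real \<Rightarrow> 'a::topological_space measure \<Rightarrow> 'a measure \<Rightarrow> 'a measure"
  where "mix t M N =
    measure_of UNIV (sets borel) (\<lambda>B. ennreal t * emeasure M B + ennreal (1 - t) * emeasure N B)"

text \<open>Weights vanish outside \<open>{1..K}\<close>, so that they are determined as functions on \<^typ>\<open>nat\<close>.\<close>

definition prob_simplex :: "nat \<Rightarrow> (nat \<Rightarrow> real) set"
  where "prob_simplex K = {\<alpha>. (\<forall>k. 0 \<le> \<alpha> k) \<and> (\<forall>k. k \<notin> {1..K} \<longrightarrow> \<alpha> k = 0) \<and> (\<Sum>k = 1..K. \<alpha> k) = 1}"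

definition conv :: "nat \<Rightarrow> (nat \<Rightarrow> 'a::topological_space measure) \<Rightarrow> 'a measure set"
  where "conv K A = mixture K A ` prob_simplex K"

text \<open>
  Affine independence in the vector space of finite signed Borel measures. It makes the family
  injective on \<open>{1..K}\<close>.
\<close>

definition affinely_independent :: "nat \<Rightarrow> (nat \<Rightarrow> 'a::topological_space measure) \<Rightarrow> bool"
  where "affinely_independent K A \<longleftrightarrow>
    (\<forall>c :: nat \<Rightarrow> real.
       (\<Sum>k = 1..K. c k) = 0 \<and> (\<forall>B \<in> sets borel. (\<Sum>k = 1..K. c k * measure (A k) B) = 0)
       \<longrightarrow> (\<forall>k \<in> {1..K}. c k = 0))"

definition jointly_convex_on ::
    "'a::topological_space measure set \<Rightarrow> ('a measure \<Rightarrow> 'a measure \<Rightarrow> real) \<Rightarrow> bool"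
  where "jointly_convex_on S \<phi> \<longleftrightarrow>
    (\<forall>r \<in> S. \<forall>r' \<in> S. \<forall>s \<in> S. \<forall>s' \<in> S. \<forall>t \<in> {0..1}.
       \<phi> (mix t r r') (mix t s s') \<le> t * \<phi> r s + (1 - t) * \<phi> r' s')"

text \<open>
  The supremum is taken in the extended reals, where it is meaningful without a priori knowledge
  of boundedness or of the existence of an admissible \<open>\<phi>\<close>. The values of \<open>\<phi>\<close> outside
  \<open>conv K A \<times> conv K A\<close> are unconstrained.
\<close>

definition SWD ::
    "nat \<Rightarrow> (nat \<Rightarrow> 'a::topological_space measure) \<Rightarrow> ('a measure \<Rightarrow> 'a measure \<Rightarrow> real)
      \<Rightarrow> 'a measure \<Rightarrow> 'a measure \<Rightarrow> ereal"
  where "SWD K A d r s =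
    (SUP \<phi> \<in> {\<phi>. jointly_convex_on (conv K A) \<phi> \<and>
                 (\<forall>k \<in> {1..K}. \<forall>l \<in> {1..K}. \<phi> (A k) (A l) = d (A k) (A l))}.
       ereal (\<phi> r s))"

definition mixing_weights ::
    "nat \<Rightarrow> (nat \<Rightarrow> 'a::topological_space measure) \<Rightarrow> 'a measure \<Rightarrow> nat \<Rightarrow> real"
  where "mixing_weights K A r = (THE \<alpha>. \<alpha> \<in> prob_simplex K \<and> r = mixture K A \<alpha>)"

text \<open>
  The pushforward along \<open>A\<close> of the weights on indices, that is \<open>\<Sum>\<^sub>k \<alpha>\<^sub>k \<delta>\<^bsub>A\<^sub>k\<^esub>\<close>.
\<close>

definition mixing_measure ::
    "nat \<Rightarrow> (nat \<Rightarrow> 'a::topological_space measure) \<Rightarrow> 'a measure \<Rightarrow> 'a measure pmf"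
  where "mixing_measure K A r = map_pmf A (embed_pmf (mixing_weights K A r))"

text \<open>
  The infimum is over a set of reals that is bounded below by \<open>0\<close> and, for \<open>P\<close> and \<open>Q\<close> supported
  on distinct points \<open>A\<^sub>1, \<dots>, A\<^sub>K\<close>, contains the cost of the product coupling.
\<close>

definition Wasserstein ::
    "nat \<Rightarrow> ('p \<Rightarrow> 'p \<Rightarrow> real) \<Rightarrow> (nat \<Rightarrow> 'p) \<Rightarrow> 'p pmf \<Rightarrow> 'p pmf \<Rightarrow> real"
  where "Wasserstein K d A P Q =
    Inf {(\<Sum>k = 1..K. \<Sum>l = 1..K. \<gamma> k l * d (A k) (A l)) | \<gamma> :: nat \<Rightarrow> nat \<Rightarrow> real.
           (\<forall>k \<in> {1..K}. \<forall>l \<in> {1..K}. 0 \<le> \<gamma> k l) \<and>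
           (\<forall>k \<in> {1..K}. (\<Sum>l = 1..K. \<gamma> k l) = pmf P (A k)) \<and>
           (\<forall>l \<in> {1..K}. (\<Sum>k = 1..K. \<gamma> k l) = pmf Q (A l))}"


text \<open>The definitions through \<^const>\<open>measure_of\<close>, \<open>THE\<close> and \<^const>\<open>embed_pmf\<close> behave as intended.\<close>

lemma sets_mixture [simp]: "sets (mixture K A \<alpha>) = sets borel"
  and space_mixture [simp]: "space (mixture K A \<alpha>) = UNIV"
  unfolding mixture_def
  by (metis sets.sigma_sets_eq sets_measure_of space_borel top_greatest Pow_UNIV)
    (simp add: space_measure_of_conv)

lemma sets_mix [simp]: "sets (mix t M N) = sets borel"
  and space_mix [simp]: "space (mix t M N) = UNIV"
  unfolding mix_def
  by (metis sets.sigma_sets_eq sets_measure_of space_borel top_greatest Pow_UNIV)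
    (simp add: space_measure_of_conv)

lemma emeasure_mixture:
  fixes A :: "nat \<Rightarrow> 'a::topological_space measure"
  assumes A: "\<And>k. k \<in> {1..K} \<Longrightarrow> sets (A k) = sets borel" and B: "B \<in> sets borel"
  shows "emeasure (mixture K A \<alpha>) B = (\<Sum>k = 1..K. ennreal (\<alpha> k) * emeasure (A k) B)"
proof -
  let ?\<mu> = "\<lambda>B. \<Sum>k = 1..K. ennreal (\<alpha> k) * emeasure (A k) B"
  have "sigma_algebra (UNIV :: 'a set) (sets borel)"
    using sets.sigma_algebra_axioms[of "borel :: 'a measure"] by simp
  moreover have "positive (sets borel) ?\<mu>"
    by (simp add: positive_def)
  moreover have "countably_additive (sets borel) ?\<mu>"
  proof (rule countably_additiveI)
    fix F :: "nat \<Rightarrow> 'a set"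
    assume F: "range F \<subseteq> sets borel" "disjoint_family F"
    have "(\<Sum>i. ?\<mu> (F i)) = (\<Sum>k = 1..K. \<Sum>i. ennreal (\<alpha> k) * emeasure (A k) (F i))"
      by (rule suminf_sum) simp
    also have "\<dots> = (\<Sum>k = 1..K. ennreal (\<alpha> k) * emeasure (A k) (\<Union>i. F i))"
    proof (rule sum.cong[OF refl])
      fix k assume "k \<in> {1..K}"
      then have "(\<Sum>i. emeasure (A k) (F i)) = emeasure (A k) (\<Union>i. F i)"
        using F A by (intro suminf_emeasure) auto
      then show "(\<Sum>i. ennreal (\<alpha> k) * emeasure (A k) (F i)) =
          ennreal (\<alpha> k) * emeasure (A k) (\<Union>i. F i)"
        by (simp add: ennreal_suminf_cmult)
    qed
    finally show "(\<Sum>i. ?\<mu> (F i)) = ?\<mu> (\<Union>i. F i)" .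
  qed
  ultimately show ?thesis
    unfolding mixture_def using B by (intro emeasure_measure_of_sigma)
qed

lemma emeasure_mix:
  fixes M N :: "'a::topological_space measure"
  assumes "sets M = sets borel" "sets N = sets borel" and B: "B \<in> sets borel"
  shows "emeasure (mix t M N) B = ennreal t * emeasure M B + ennreal (1 - t) * emeasure N B"
proof -
  have "mix t M N =
      mixture 2 (\<lambda>k. if k = 1 then M else N) (\<lambda>k. if k = 1 then t else 1 - t)"
    by (simp add: mix_def mixture_def numeral_2_eq_2)
  then show ?thesis
    using assms by (simp add: emeasure_mixture numeral_2_eq_2)
qed

lemma measure_mixture:
  fixes A :: "nat \<Rightarrow> 'a::topological_space measure"
  assumes A: "\<And>k. k \<in> {1..K} \<Longrightarrow> A k \<in> space (prob_algebra borel)"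
    and \<alpha>: "\<alpha> \<in> prob_simplex K" and B: "B \<in> sets borel"
  shows "measure (mixture K A \<alpha>) B = (\<Sum>k = 1..K. \<alpha> k * measure (A k) B)"
proof -
  have pr: "prob_space (A k)" "sets (A k) = sets borel" if "k \<in> {1..K}" for k
    using A[OF that] by (auto simp: space_prob_algebra)
  have nn: "0 \<le> \<alpha> k" for k using \<alpha> by (simp add: prob_simplex_def)
  have "emeasure (mixture K A \<alpha>) B = (\<Sum>k = 1..K. ennreal (\<alpha> k) * emeasure (A k) B)"
    using pr B by (intro emeasure_mixture) auto
  also have "\<dots> = (\<Sum>k = 1..K. ennreal (\<alpha> k * measure (A k) B))"
  proof (rule sum.cong[OF refl])
    fix k assume "k \<in> {1..K}"
    then interpret prob_space "A k" using pr by simp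
    show "ennreal (\<alpha> k) * emeasure (A k) B = ennreal (\<alpha> k * measure (A k) B)"
      by (simp add: emeasure_eq_measure ennreal_mult nn)
  qed
  also have "\<dots> = ennreal (\<Sum>k = 1..K. \<alpha> k * measure (A k) B)"
    by (rule sum_ennreal) (simp add: nn)
  finally show ?thesis
    by (simp add: measure_def sum_nonneg nn)
qed

lemma mixing_weights_mixture:
  fixes A :: "nat \<Rightarrow> 'a::topological_space measure"
  assumes A: "\<And>k. k \<in> {1..K} \<Longrightarrow> A k \<in> space (prob_algebra borel)"
    and ind: "affinely_independent K A" and \<alpha>: "\<alpha> \<in> prob_simplex K"
  shows "mixing_weights K A (mixture K A \<alpha>) = \<alpha>"
  unfolding mixing_weights_def
proof (rule the_equality)
  show "\<alpha> \<in> prob_simplex K \<and> mixture K A \<alpha> = mixture K A \<alpha>" using \<alpha> by simp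
next
  fix \<beta> assume \<beta>: "\<beta> \<in> prob_simplex K \<and> mixture K A \<alpha> = mixture K A \<beta>"
  have "(\<Sum>k = 1..K. (\<beta> k - \<alpha> k) * measure (A k) B) = 0" if "B \<in> sets borel" for B
  proof -
    have "measure (mixture K A \<alpha>) B = (\<Sum>k = 1..K. \<alpha> k * measure (A k) B)"
      by (rule measure_mixture) (use A \<alpha> that in auto)
    moreover have "measure (mixture K A \<beta>) B = (\<Sum>k = 1..K. \<beta> k * measure (A k) B)"
      by (rule measure_mixture) (use A \<beta> that in auto)
    ultimately show ?thesis
      using \<beta> by (simp add: left_diff_distrib sum_subtractf)
  qed
  moreover have "(\<Sum>k = 1..K. \<beta> k - \<alpha> k) = 0"
    using \<alpha> \<beta> by (simp add: prob_simplex_def sum_subtractf)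
  ultimately have "\<forall>k \<in> {1..K}. \<beta> k - \<alpha> k = 0"
    using ind[unfolded affinely_independent_def, THEN spec, of "\<lambda>k. \<beta> k - \<alpha> k"] by blast
  then have "\<beta> k = \<alpha> k" for k
    using \<alpha> \<beta> by (cases "k \<in> {1..K}") (auto simp: prob_simplex_def)
  then show "\<beta> = \<alpha>" by blast
qed

lemma affinely_independent_inj:
  assumes "affinely_independent K A"
  shows "inj_on A {1..K}"
proof (rule inj_onI, rule ccontr)
  fix i j assume ij: "i \<in> {1..K}" "j \<in> {1..K}" "A i = A j" "i \<noteq> j"
  define c :: "nat \<Rightarrow> real" where "c k = of_bool (k = i) - of_bool (k = j)" for k
  have c: "(\<Sum>k = 1..K. c k * f k) = f i - f j" for f
  proof -
    have "(\<Sum>k = 1..K. c k * f k) = (\<Sum>k = 1..K. if k = i then f k else 0) - (\<Sum>k = 1..K. if k = j then f k else 0)"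
      unfolding sum_subtractf[symmetric] by (rule sum.cong) (auto simp: c_def)
    then show ?thesis
      using ij by (simp add: sum.delta)
  qed
  have "(\<Sum>k = 1..K. c k) = 0"
    using c[of "\<lambda>_. 1"] by simp
  moreover have "(\<Sum>k = 1..K. c k * measure (A k) B) = 0" for B
    using c[of "\<lambda>k. measure (A k) B"] ij(3) by simp
  ultimately have "c i = 0"
    using assms[unfolded affinely_independent_def, THEN spec, of c] ij(1) by blast
  then show False using ij by (simp add: c_def)
qed

lemma pmf_mixing_measure:
  fixes A :: "nat \<Rightarrow> 'a::topological_space measure"
  assumes A: "\<And>k. k \<in> {1..K} \<Longrightarrow> A k \<in> space (prob_algebra borel)"
    and ind: "affinely_independent K A" and \<alpha>: "\<alpha> \<in> prob_simplex K" and k: "k \<in> {1..K}"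
  shows "pmf (mixing_measure K A (mixture K A \<alpha>)) (A k) = \<alpha> k"
proof -
  have nn: "0 \<le> \<alpha> k" for k using \<alpha> by (simp add: prob_simplex_def)
  have zero: "\<alpha> i = 0" if "i \<notin> {1..K}" for i using \<alpha> that by (simp add: prob_simplex_def)
  have "(\<integral>\<^sup>+ i. ennreal (\<alpha> i) \<partial>count_space UNIV) = (\<Sum>i = 1..K. ennreal (\<alpha> i))"
    using zero by (intro nn_integral_count_space') auto
  also have "\<dots> = 1"
    using \<alpha> nn by (simp add: sum_ennreal prob_simplex_def)
  finally have p: "pmf (embed_pmf \<alpha>) i = \<alpha> i" for i
    using nn by (intro pmf_embed_pmf) auto
  have supp: "set_pmf (embed_pmf \<alpha>) \<subseteq> {1..K}"
    using zero p by (metis pmf_eq_0_set_pmf subsetI)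
  have "pmf (map_pmf A (embed_pmf \<alpha>)) (A k) =
      measure (measure_pmf (embed_pmf \<alpha>)) ((A -` {A k}) \<inter> set_pmf (embed_pmf \<alpha>))"
    by (simp add: pmf_map measure_Int_set_pmf)
  also have "(A -` {A k}) \<inter> set_pmf (embed_pmf \<alpha>) = {k} \<inter> set_pmf (embed_pmf \<alpha>)"
    using supp k affinely_independent_inj[OF ind] by (auto dest: inj_onD)
  also have "measure (measure_pmf (embed_pmf \<alpha>)) \<dots> = \<alpha> k"
    by (simp add: measure_Int_set_pmf measure_pmf_single p)
  finally show ?thesis
    using mixing_weights_mixture[OF A ind \<alpha>] by (simp add: mixing_measure_def)
qed

end

theory Submission
  imports Defs
begin

text \<open>
  In the coordinates \<open>\<alpha>\<close> of the simplex the theorem identifies the largest jointly convex extension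
  of the cost matrix \<open>c k l = d (A k) (A l)\<close> from pairs of vertices to pairs of points. A coupling
  \<open>\<gamma>\<close> of \<open>\<alpha>\<close> and \<open>\<beta>\<close> is the same thing as a way of writing the pair \<open>(\<alpha>, \<beta>)\<close> as a convex
  combination \<open>\<Sum>\<^sub>k\<^sub>l \<gamma>\<^sub>k\<^sub>l (\<delta>\<^sub>k, \<delta>\<^sub>l)\<close> of pairs of vertices. Two inequalities follow.

  \<^item> Jensen's inequality along such a combination (\<open>jensen_on_simplex_pairs\<close>) bounds every
    admissible \<open>\<phi>\<close> by the cost of every coupling (\<open>jointly_convex_le_coupling_cost\<close>), hence by the
    optimal cost.
  \<^item> The optimal cost is itself admissible. It is jointly convex, because couplings of two pairs
    of weights mix to a coupling of the mixed pairs (\<open>transport_cost_convex\<close>). At a pair of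
    vertices it equals the cost matrix, because the only coupling of two point masses is the point
    mass at the pair (\<open>transport_cost_point_weight\<close>).

  So the optimal cost is the largest admissible function and the supremum is attained. Affine independence is what makes the
  weights of a point of \<open>conv K A\<close> well defined, so that the optimal cost is a function on
  \<open>conv K A\<close>.
\<close>

section \<open>Mixtures in simplex coordinates\<close>

text \<open>The vertex of the simplex written \<open>\<delta>\<^sub>k\<close> in the explanations.\<close>

definition point_weight :: "nat \<Rightarrow> nat \<Rightarrow> real"
  where "point_weight k = (\<lambda>i. of_bool (i = k))"

lemma point_weight_in_prob_simplex:
  assumes "k \<in> {1..K}"
  shows "point_weight k \<in> prob_simplex K"
proof -
  have "(\<Sum>i = 1..K. point_weight k i) = (\<Sum>i = 1..K. if i = k then 1 else 0)"
    by (rule sum.cong) (auto simp: point_weight_def)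
  then show ?thesis
    using assms by (auto simp: prob_simplex_def point_weight_def)
qed

lemma mixture_point_weight:
  fixes A :: "nat \<Rightarrow> 'a::topological_space measure"
  assumes A: "\<And>k. k \<in> {1..K} \<Longrightarrow> sets (A k) = sets borel" and k: "k \<in> {1..K}"
  shows "mixture K A (point_weight k) = A k"
proof (rule measure_eqI)
  show "sets (mixture K A (point_weight k)) = sets (A k)" using A k by simp
next
  fix B assume "B \<in> sets (mixture K A (point_weight k))"
  then have "emeasure (mixture K A (point_weight k)) B =
      (\<Sum>i = 1..K. ennreal (point_weight k i) * emeasure (A i) B)"
    using A by (intro emeasure_mixture) auto
  also have "\<dots> = (\<Sum>i = 1..K. if i = k then emeasure (A i) B else 0)"
    by (rule sum.cong) (auto simp: point_weight_def)
  also have "\<dots> = emeasure (A k) B" using k by simp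
  finally show "emeasure (mixture K A (point_weight k)) B = emeasure (A k) B" .
qed

lemma prob_simplex_convex:
  assumes "\<alpha> \<in> prob_simplex K" "\<beta> \<in> prob_simplex K" "t \<in> {0..1}"
  shows "(\<lambda>k. t * \<alpha> k + (1 - t) * \<beta> k) \<in> prob_simplex K"
proof -
  have "(\<Sum>k = 1..K. t * \<alpha> k + (1 - t) * \<beta> k) =
      t * (\<Sum>k = 1..K. \<alpha> k) + (1 - t) * (\<Sum>k = 1..K. \<beta> k)"
    by (simp add: sum.distrib sum_distrib_left)
  then show ?thesis
    using assms by (auto simp: prob_simplex_def)
qed

text \<open>This carries joint convexity on \<open>conv K A\<close> over to joint convexity on the simplex.\<close>

lemma mix_mixture:
  fixes A :: "nat \<Rightarrow> 'a::topological_space measure"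
  assumes A: "\<And>k. k \<in> {1..K} \<Longrightarrow> sets (A k) = sets borel"
    and \<alpha>: "\<alpha> \<in> prob_simplex K" and \<beta>: "\<beta> \<in> prob_simplex K" and t: "t \<in> {0..1}"
  shows "mix t (mixture K A \<alpha>) (mixture K A \<beta>) = mixture K A (\<lambda>k. t * \<alpha> k + (1 - t) * \<beta> k)"
proof (rule measure_eqI)
  fix B assume "B \<in> sets (mix t (mixture K A \<alpha>) (mixture K A \<beta>))"
  then have B: "B \<in> sets borel" by simp
  have nn: "0 \<le> \<alpha> k" "0 \<le> \<beta> k" for k using \<alpha> \<beta> by (auto simp: prob_simplex_def)
  have "emeasure (mix t (mixture K A \<alpha>) (mixture K A \<beta>)) B =
      ennreal t * (\<Sum>k = 1..K. ennreal (\<alpha> k) * emeasure (A k) B) +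
      ennreal (1 - t) * (\<Sum>k = 1..K. ennreal (\<beta> k) * emeasure (A k) B)"
    by (simp only: emeasure_mix[OF sets_mixture sets_mixture B] emeasure_mixture[where A = A, OF A B])
  also have "\<dots> = (\<Sum>k = 1..K. ennreal (t * \<alpha> k + (1 - t) * \<beta> k) * emeasure (A k) B)"
    using nn t
    by (simp add: sum_distrib_left sum.distrib ennreal_plus ennreal_mult distrib_right mult.assoc)
  also have "\<dots> = emeasure (mixture K A (\<lambda>k. t * \<alpha> k + (1 - t) * \<beta> k)) B"
    by (simp only: emeasure_mixture[where A = A, OF A B])
  finally show "emeasure (mix t (mixture K A \<alpha>) (mixture K A \<beta>)) B =
      emeasure (mixture K A (\<lambda>k. t * \<alpha> k + (1 - t) * \<beta> k)) B" .
qed simp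

section \<open>Jensen's inequality for jointly convex functions\<close>

text \<open>
  Split off one pair and renormalise the remaining weights. That the mixed weights stay in the
  simplex is proved in the same induction, because \<open>F\<close> is convex only there: the induction
  hypothesis must supply a pair to which convexity applies again.
\<close>

lemma jensen_on_simplex_pairs:
  fixes F :: "(nat \<Rightarrow> real) \<Rightarrow> (nat \<Rightarrow> real) \<Rightarrow> real"
  assumes F: "\<And>\<alpha> \<alpha>' \<beta> \<beta>' t. \<alpha> \<in> prob_simplex K \<Longrightarrow> \<alpha>' \<in> prob_simplex K \<Longrightarrow>
      \<beta> \<in> prob_simplex K \<Longrightarrow> \<beta>' \<in> prob_simplex K \<Longrightarrow> t \<in> {0..1} \<Longrightarrow>
      F (\<lambda>k. t * \<alpha> k + (1 - t) * \<alpha>' k) (\<lambda>k. t * \<beta> k + (1 - t) * \<beta>' k)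
        \<le> t * F \<alpha> \<beta> + (1 - t) * F \<alpha>' \<beta>'"
    and "finite I" "\<And>i. i \<in> I \<Longrightarrow> 0 \<le> w i" "(\<Sum>i\<in>I. w i) = 1"
    and "\<And>i. i \<in> I \<Longrightarrow> a i \<in> prob_simplex K" "\<And>i. i \<in> I \<Longrightarrow> b i \<in> prob_simplex K"
  shows "(\<lambda>k. \<Sum>i\<in>I. w i * a i k) \<in> prob_simplex K \<and> (\<lambda>k. \<Sum>i\<in>I. w i * b i k) \<in> prob_simplex K \<and>
    F (\<lambda>k. \<Sum>i\<in>I. w i * a i k) (\<lambda>k. \<Sum>i\<in>I. w i * b i k) \<le> (\<Sum>i\<in>I. w i * F (a i) (b i))"
  using assms(2-)
proof (induction I arbitrary: w rule: finite_induct)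
  case empty
  then show ?case by simp
next
  case (insert j I)
  \<comment> \<open>The renormalisation divides by \<open>1 - w j\<close>; if that is zero, all other weights vanish.\<close>
  have w: "w j + (\<Sum>i\<in>I. w i) = 1" and nn: "0 \<le> w j" "\<And>i. i \<in> I \<Longrightarrow> 0 \<le> w i"
    using insert by auto
  show ?case
  proof (cases "w j = 1")
    case True
    then have "(\<Sum>i\<in>I. w i) = 0" using w by simp
    then have "\<And>i. i \<in> I \<Longrightarrow> w i = 0" using nn insert.hyps by (simp add: sum_nonneg_eq_0_iff)
    then show ?thesis using True insert by simp
  next
    case False
    define v where "v i = w i / (1 - w j)" for i
    have less: "w j < 1" using False w nn sum_nonneg[of I w] by fastforce
    have "(\<Sum>i\<in>I. v i) = 1"
      using w less by (simp add: v_def flip: sum_divide_distrib)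
    moreover have "\<And>i. i \<in> I \<Longrightarrow> 0 \<le> v i" using nn less by (simp add: v_def)
    ultimately have IH: "(\<lambda>k. \<Sum>i\<in>I. v i * a i k) \<in> prob_simplex K"
      "(\<lambda>k. \<Sum>i\<in>I. v i * b i k) \<in> prob_simplex K"
      "F (\<lambda>k. \<Sum>i\<in>I. v i * a i k) (\<lambda>k. \<Sum>i\<in>I. v i * b i k) \<le> (\<Sum>i\<in>I. v i * F (a i) (b i))"
      using insert.IH[of v] insert.prems by auto
    have t: "w j \<in> {0..1}" using nn less by simp
    have split: "(\<Sum>i\<in>insert j I. w i * g i) = w j * g j + (1 - w j) * (\<Sum>i\<in>I. v i * g i)"
      for g :: "'a \<Rightarrow> real"
      using insert.hyps less by (simp add: v_def sum_distrib_left)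
    have in_simplex: "a j \<in> prob_simplex K" "b j \<in> prob_simplex K" using insert.prems by auto
    have "F (\<lambda>k. w j * a j k + (1 - w j) * (\<Sum>i\<in>I. v i * a i k))
        (\<lambda>k. w j * b j k + (1 - w j) * (\<Sum>i\<in>I. v i * b i k))
      \<le> w j * F (a j) (b j) + (1 - w j) * F (\<lambda>k. \<Sum>i\<in>I. v i * a i k) (\<lambda>k. \<Sum>i\<in>I. v i * b i k)"
      by (rule F[OF in_simplex(1) IH(1) in_simplex(2) IH(2) t])
    also have "\<dots> \<le> w j * F (a j) (b j) + (1 - w j) * (\<Sum>i\<in>I. v i * F (a i) (b i))"
      using IH(3) less by (intro add_left_mono mult_left_mono) auto
    finally show ?thesis
      unfolding split
      using prob_simplex_convex[OF in_simplex(1) IH(1) t] prob_simplex_convex[OF in_simplex(2) IH(2) t]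
      by blast
  qed
qed

section \<open>Optimal transport between weights\<close>

definition couplings :: "nat \<Rightarrow> (nat \<Rightarrow> real) \<Rightarrow> (nat \<Rightarrow> real) \<Rightarrow> (nat \<Rightarrow> nat \<Rightarrow> real) set"
  where "couplings K \<alpha> \<beta> = {\<gamma>.
    (\<forall>k \<in> {1..K}. \<forall>l \<in> {1..K}. 0 \<le> \<gamma> k l) \<and>
    (\<forall>k \<in> {1..K}. (\<Sum>l = 1..K. \<gamma> k l) = \<alpha> k) \<and>
    (\<forall>l \<in> {1..K}. (\<Sum>k = 1..K. \<gamma> k l) = \<beta> l)}"

definition coupling_cost :: "nat \<Rightarrow> (nat \<Rightarrow> nat \<Rightarrow> real) \<Rightarrow> (nat \<Rightarrow> nat \<Rightarrow> real) \<Rightarrow> real"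
  where "coupling_cost K c \<gamma> = (\<Sum>k = 1..K. \<Sum>l = 1..K. \<gamma> k l * c k l)"

definition transport_cost ::
    "nat \<Rightarrow> (nat \<Rightarrow> nat \<Rightarrow> real) \<Rightarrow> (nat \<Rightarrow> real) \<Rightarrow> (nat \<Rightarrow> real) \<Rightarrow> real"
  where "transport_cost K c \<alpha> \<beta> = Inf (coupling_cost K c ` couplings K \<alpha> \<beta>)"

lemma couplings_nonempty:
  assumes "\<alpha> \<in> prob_simplex K" "\<beta> \<in> prob_simplex K"
  shows "couplings K \<alpha> \<beta> \<noteq> {}"
proof -
  have "(\<lambda>k l. \<alpha> k * \<beta> l) \<in> couplings K \<alpha> \<beta>"
    using assms by (simp add: couplings_def prob_simplex_def flip: sum_distrib_left sum_distrib_right)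
  then show ?thesis by blast
qed

lemma transport_cost_le:
  assumes c: "\<And>k l. k \<in> {1..K} \<Longrightarrow> l \<in> {1..K} \<Longrightarrow> 0 \<le> c k l" and \<gamma>: "\<gamma> \<in> couplings K \<alpha> \<beta>"
  shows "transport_cost K c \<alpha> \<beta> \<le> coupling_cost K c \<gamma>"
proof -
  have "0 \<le> coupling_cost K c \<gamma>'" if "\<gamma>' \<in> couplings K \<alpha> \<beta>" for \<gamma>'
    using that c by (auto simp: couplings_def coupling_cost_def intro!: sum_nonneg mult_nonneg_nonneg)
  then have "bdd_below (coupling_cost K c ` couplings K \<alpha> \<beta>)"
    by (rule bdd_belowI2)
  then show ?thesis
    unfolding transport_cost_def using \<gamma> by (auto intro: cInf_lower)
qed

lemma couplings_convex:
  assumes \<gamma>: "\<gamma> \<in> couplings K \<alpha> \<beta>" and \<gamma>': "\<gamma>' \<in> couplings K \<alpha>' \<beta>'" and t: "t \<in> {0..1}"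
  shows "(\<lambda>k l. t * \<gamma> k l + (1 - t) * \<gamma>' k l) \<in>
    couplings K (\<lambda>k. t * \<alpha> k + (1 - t) * \<alpha>' k) (\<lambda>k. t * \<beta> k + (1 - t) * \<beta>' k)"
  using assms by (auto simp: couplings_def sum.distrib simp flip: sum_distrib_left)

lemma coupling_cost_mix:
  "coupling_cost K c (\<lambda>k l. t * \<gamma> k l + (1 - t) * \<gamma>' k l) =
    t * coupling_cost K c \<gamma> + (1 - t) * coupling_cost K c \<gamma>'"
  by (simp add: coupling_cost_def sum.distrib sum_distrib_left distrib_right mult.assoc)

text \<open>
  The cost is linear in the coupling, and the set of triples \<open>(\<alpha>, \<beta>, \<gamma>)\<close> with \<open>\<gamma>\<close> a coupling of
  \<open>\<alpha>\<close> and \<open>\<beta>\<close> is convex, so the infimum over \<open>\<gamma>\<close> is convex in the remaining variables. Concretely,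
  couplings within \<open>e\<close> of the two optimal costs mix to a coupling within \<open>e\<close> of their mixture.
\<close>

lemma transport_cost_convex:
  assumes c: "\<And>k l. k \<in> {1..K} \<Longrightarrow> l \<in> {1..K} \<Longrightarrow> 0 \<le> c k l"
    and "\<alpha> \<in> prob_simplex K" "\<alpha>' \<in> prob_simplex K" "\<beta> \<in> prob_simplex K" "\<beta>' \<in> prob_simplex K"
    and t: "t \<in> {0..1}"
  shows "transport_cost K c (\<lambda>k. t * \<alpha> k + (1 - t) * \<alpha>' k) (\<lambda>k. t * \<beta> k + (1 - t) * \<beta>' k)
    \<le> t * transport_cost K c \<alpha> \<beta> + (1 - t) * transport_cost K c \<alpha>' \<beta>'"
    (is "?L \<le> t * ?T + (1 - t) * ?T'")
proof (rule field_le_epsilon)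
  fix e :: real assume e: "0 < e"
  have near_optimal: "\<exists>\<gamma> \<in> couplings K \<mu> \<nu>. coupling_cost K c \<gamma> < transport_cost K c \<mu> \<nu> + e"
    if "\<mu> \<in> prob_simplex K" "\<nu> \<in> prob_simplex K" for \<mu> \<nu>
    using cInf_lessD[of "coupling_cost K c ` couplings K \<mu> \<nu>" "transport_cost K c \<mu> \<nu> + e"]
      couplings_nonempty[OF that] e by (auto simp: transport_cost_def)
  obtain \<gamma> where \<gamma>: "\<gamma> \<in> couplings K \<alpha> \<beta>" "coupling_cost K c \<gamma> < ?T + e"
    using near_optimal assms by blast
  obtain \<gamma>' where \<gamma>': "\<gamma>' \<in> couplings K \<alpha>' \<beta>'" "coupling_cost K c \<gamma>' < ?T' + e"
    using near_optimal assms by blast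
  have "?L \<le> t * coupling_cost K c \<gamma> + (1 - t) * coupling_cost K c \<gamma>'"
    using transport_cost_le[OF c couplings_convex[OF \<gamma>(1) \<gamma>'(1) t]] by (simp add: coupling_cost_mix)
  also have "\<dots> \<le> t * (?T + e) + (1 - t) * (?T' + e)"
    using \<gamma>(2) \<gamma>'(2) t by (intro add_mono mult_left_mono) auto
  also have "\<dots> = t * ?T + (1 - t) * ?T' + e" by (simp add: algebra_simps)
  finally show "?L \<le> t * ?T + (1 - t) * ?T' + e" .
qed

text \<open>
  A coupling of two point masses has no mass off the row and the column of these points, so every
  coupling has the same cost.
\<close>

lemma transport_cost_point_weight:
  assumes k: "k \<in> {1..K}" and l: "l \<in> {1..K}"
  shows "transport_cost K c (point_weight k) (point_weight l) = c k l"
proof -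
  have "coupling_cost K c \<gamma> = c k l" if "\<gamma> \<in> couplings K (point_weight k) (point_weight l)" for \<gamma>
  proof -
    have nn: "0 \<le> \<gamma> i j" if "i \<in> {1..K}" "j \<in> {1..K}" for i j
      using \<open>\<gamma> \<in> _\<close> that by (simp add: couplings_def)
    have row: "(\<Sum>j = 1..K. \<gamma> i j) = of_bool (i = k)" if "i \<in> {1..K}" for i
      using \<open>\<gamma> \<in> _\<close> that by (simp add: couplings_def point_weight_def)
    have col: "(\<Sum>i = 1..K. \<gamma> i j) = of_bool (j = l)" if "j \<in> {1..K}" for j
      using \<open>\<gamma> \<in> _\<close> that by (simp add: couplings_def point_weight_def)
    have zero: "\<gamma> i j = 0" if "i \<in> {1..K}" "j \<in> {1..K}" "i \<noteq> k \<or> j \<noteq> l" for i j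
    proof (cases "i = k")
      case False
      then show ?thesis using sum_nonneg_0[of "{1..K}" "\<gamma> i" j] row[of i] nn that by auto
    next
      case True
      then show ?thesis using sum_nonneg_0[of "{1..K}" "\<lambda>i. \<gamma> i j" i] col[of j] nn that by auto
    qed
    have "(\<Sum>j = 1..K. \<gamma> k j) = (\<Sum>j = 1..K. if j = l then \<gamma> k l else 0)"
      by (rule sum.cong) (use zero k in auto)
    then have one: "\<gamma> k l = 1" using row[OF k] l by simp
    have "coupling_cost K c \<gamma> = (\<Sum>i = 1..K. \<Sum>j = 1..K. if i = k then if j = l then c k l else 0 else 0)"
      unfolding coupling_cost_def by (intro sum.cong refl) (use zero one in auto)
    also have "\<dots> = (\<Sum>i = 1..K. if i = k then c k l else 0)"
      using l by (intro sum.cong refl) auto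
    also have "\<dots> = c k l" using k by simp
    finally show ?thesis .
  qed
  moreover have "couplings K (point_weight k) (point_weight l) \<noteq> {}"
    using k l by (intro couplings_nonempty point_weight_in_prob_simplex)
  ultimately have "coupling_cost K c ` couplings K (point_weight k) (point_weight l) = {c k l}"
    by auto
  then show ?thesis by (simp add: transport_cost_def)
qed

section \<open>The two inequalities\<close>

text \<open>
  The row and column sums of \<open>\<gamma>\<close> say exactly that \<open>(\<alpha>, \<beta>) = \<Sum>\<^sub>k\<^sub>l \<gamma>\<^sub>k\<^sub>l (\<delta>\<^sub>k, \<delta>\<^sub>l)\<close>, and Jensen's
  inequality applies to this convex combination.
\<close>

lemma jointly_convex_le_coupling_cost:
  fixes A :: "nat \<Rightarrow> 'a::topological_space measure"
  assumes A: "\<And>k. k \<in> {1..K} \<Longrightarrow> sets (A k) = sets borel"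
    and \<phi>: "jointly_convex_on (conv K A) \<phi>"
    and \<alpha>: "\<alpha> \<in> prob_simplex K" and \<beta>: "\<beta> \<in> prob_simplex K" and \<gamma>: "\<gamma> \<in> couplings K \<alpha> \<beta>"
  shows "\<phi> (mixture K A \<alpha>) (mixture K A \<beta>) \<le> coupling_cost K (\<lambda>k l. \<phi> (A k) (A l)) \<gamma>"
proof -
  define F where "F a b = \<phi> (mixture K A a) (mixture K A b)" for a b
  let ?I = "{1..K} \<times> {1..K}"
  let ?w = "\<lambda>(k, l). \<gamma> k l"
  let ?a = "\<lambda>(k, l). point_weight k" and ?b = "\<lambda>(k :: nat, l). point_weight l"
  have F: "F (\<lambda>k. t * a k + (1 - t) * a' k) (\<lambda>k. t * b k + (1 - t) * b' k)
        \<le> t * F a b + (1 - t) * F a' b'"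
    if "a \<in> prob_simplex K" "a' \<in> prob_simplex K" "b \<in> prob_simplex K" "b' \<in> prob_simplex K"
      "t \<in> {0..1}" for a a' b b' t
  proof -
    have "mixture K A (\<lambda>k. t * a k + (1 - t) * a' k) = mix t (mixture K A a) (mixture K A a')"
      "mixture K A (\<lambda>k. t * b k + (1 - t) * b' k) = mix t (mixture K A b) (mixture K A b')"
      using that by (simp_all only: mix_mixture A)
    then show ?thesis
      using \<phi> that by (simp add: F_def jointly_convex_on_def conv_def)
  qed
  \<comment> \<open>The sums below produce weights on all of \<^typ>\<open>nat\<close>, whereas \<open>\<gamma>\<close> controls only \<open>{1..K}\<close>.\<close>
  have outside: "\<alpha> i = 0" "\<beta> i = 0" if "i \<notin> {1..K}" for i
    using \<alpha> \<beta> that by (auto simp: prob_simplex_def)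
  have "(\<Sum>p\<in>?I. ?w p) = (\<Sum>k = 1..K. \<Sum>l = 1..K. \<gamma> k l)"
    by (simp add: sum.cartesian_product)
  also have "\<dots> = 1" using \<gamma> \<alpha> by (simp add: couplings_def prob_simplex_def)
  finally have total: "(\<Sum>p\<in>?I. ?w p) = 1" .
  have first: "(\<lambda>i. \<Sum>p\<in>?I. ?w p * ?a p i) = \<alpha>"
  proof
    fix i
    have "(\<Sum>p\<in>?I. ?w p * ?a p i) = (\<Sum>k = 1..K. \<Sum>l = 1..K. \<gamma> k l * point_weight k i)"
      by (simp add: sum.cartesian_product case_prod_unfold)
    also have "\<dots> = (\<Sum>k = 1..K. if k = i then \<alpha> i else 0)"
      using \<gamma> by (intro sum.cong refl) (auto simp: couplings_def point_weight_def)
    also have "\<dots> = \<alpha> i" using outside[of i] by simp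
    finally show "(\<Sum>p\<in>?I. ?w p * ?a p i) = \<alpha> i" .
  qed
  have second: "(\<lambda>i. \<Sum>p\<in>?I. ?w p * ?b p i) = \<beta>"
  proof
    fix i
    have "(\<Sum>p\<in>?I. ?w p * ?b p i) = (\<Sum>k = 1..K. \<Sum>l = 1..K. \<gamma> k l * point_weight l i)"
      by (simp add: sum.cartesian_product case_prod_unfold)
    also have "\<dots> = (\<Sum>l = 1..K. \<Sum>k = 1..K. \<gamma> k l * point_weight l i)" by (rule sum.swap)
    also have "\<dots> = (\<Sum>l = 1..K. if l = i then \<beta> i else 0)"
      using \<gamma> by (intro sum.cong refl) (auto simp: couplings_def point_weight_def)
    also have "\<dots> = \<beta> i" using outside[of i] by simp
    finally show "(\<Sum>p\<in>?I. ?w p * ?b p i) = \<beta> i" .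
  qed
  have "F (\<lambda>i. \<Sum>p\<in>?I. ?w p * ?a p i) (\<lambda>i. \<Sum>p\<in>?I. ?w p * ?b p i) \<le> (\<Sum>p\<in>?I. ?w p * F (?a p) (?b p))"
    using \<gamma> total
    by (intro jensen_on_simplex_pairs[of K F, THEN conjunct2, THEN conjunct2] F)
      (auto simp: couplings_def intro: point_weight_in_prob_simplex)
  also have "\<dots> = (\<Sum>k = 1..K. \<Sum>l = 1..K. \<gamma> k l * F (point_weight k) (point_weight l))"
    by (simp add: sum.cartesian_product case_prod_unfold)
  also have "\<dots> = coupling_cost K (\<lambda>k l. \<phi> (A k) (A l)) \<gamma>"
    unfolding coupling_cost_def F_def
    by (intro sum.cong refl) (simp only: mixture_point_weight A)
  finally show ?thesis unfolding first second by (simp add: F_def)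
qed

lemma Wasserstein_eq_transport_cost:
  assumes "\<And>k. k \<in> {1..K} \<Longrightarrow> pmf P (A k) = \<alpha> k" "\<And>k. k \<in> {1..K} \<Longrightarrow> pmf Q (A k) = \<beta> k"
  shows "Wasserstein K d A P Q = transport_cost K (\<lambda>k l. d (A k) (A l)) \<alpha> \<beta>"
  unfolding Wasserstein_def transport_cost_def couplings_def coupling_cost_def
  by (rule arg_cong[where f = Inf]) (use assms in auto)

theorem theorem1:
  fixes d :: "'y::polish_space measure \<Rightarrow> 'y measure \<Rightarrow> real"
    and A :: "nat \<Rightarrow> 'y measure" and K :: nat
  assumes "Metric_space (space (prob_algebra (borel :: 'y measure))) d"
    and "\<And>k. k \<in> {1..K} \<Longrightarrow> A k \<in> space (prob_algebra borel)"
    and "affinely_independent K A"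
    and "r1 \<in> conv K A" and "r2 \<in> conv K A"
  shows "SWD K A d r1 r2 = ereal (Wasserstein K d A (mixing_measure K A r1) (mixing_measure K A r2))"
proof -
  define c where "c = (\<lambda>k l. d (A k) (A l))"
  define W where "W r s = Wasserstein K d A (mixing_measure K A r) (mixing_measure K A s)" for r s
  have A: "sets (A k) = sets borel" if "k \<in> {1..K}" for k
    using assms(2)[OF that] by (simp add: space_prob_algebra)
  have c: "0 \<le> c k l" for k l
    using assms(1) by (simp add: c_def Metric_space.nonneg)
  have W: "W (mixture K A \<alpha>) (mixture K A \<beta>) = transport_cost K c \<alpha> \<beta>"
    if "\<alpha> \<in> prob_simplex K" "\<beta> \<in> prob_simplex K" for \<alpha> \<beta>
    unfolding W_def c_def using that assms
    by (intro Wasserstein_eq_transport_cost pmf_mixing_measure) auto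
  have W_convex: "jointly_convex_on (conv K A) W"
  proof -
    have "W (mix t (mixture K A \<alpha>) (mixture K A \<alpha>')) (mix t (mixture K A \<beta>) (mixture K A \<beta>'))
        \<le> t * W (mixture K A \<alpha>) (mixture K A \<beta>) + (1 - t) * W (mixture K A \<alpha>') (mixture K A \<beta>')"
      if simplex: "\<alpha> \<in> prob_simplex K" "\<alpha>' \<in> prob_simplex K" "\<beta> \<in> prob_simplex K" "\<beta>' \<in> prob_simplex K"
        and t: "t \<in> {0..1}" for \<alpha> \<alpha>' \<beta> \<beta>' t
      using transport_cost_convex[of K c, OF c simplex t] simplex t
      by (simp only: mix_mixture A W prob_simplex_convex)
    then show ?thesis by (auto simp: jointly_convex_on_def conv_def)
  qed
  have W_vertices: "W (A k) (A l) = d (A k) (A l)" if kl: "k \<in> {1..K}" "l \<in> {1..K}" for k l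
  proof -
    have "W (mixture K A (point_weight k)) (mixture K A (point_weight l)) = c k l"
      using kl by (simp add: W point_weight_in_prob_simplex transport_cost_point_weight)
    then show ?thesis using kl by (simp only: mixture_point_weight A c_def)
  qed
  have maximal: "\<phi> r1 r2 \<le> W r1 r2"
    if \<phi>: "jointly_convex_on (conv K A) \<phi>"
      "\<forall>k \<in> {1..K}. \<forall>l \<in> {1..K}. \<phi> (A k) (A l) = d (A k) (A l)" for \<phi>
  proof -
    obtain \<alpha> \<beta> where r: "r1 = mixture K A \<alpha>" "r2 = mixture K A \<beta>"
      and \<alpha>\<beta>: "\<alpha> \<in> prob_simplex K" "\<beta> \<in> prob_simplex K"
      using assms(4,5) by (auto simp: conv_def)
    have "\<phi> r1 r2 \<le> coupling_cost K c \<gamma>" if "\<gamma> \<in> couplings K \<alpha> \<beta>" for \<gamma>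
    proof -
      have "\<phi> r1 r2 \<le> coupling_cost K (\<lambda>k l. \<phi> (A k) (A l)) \<gamma>"
        unfolding r by (rule jointly_convex_le_coupling_cost[OF A \<phi>(1) \<alpha>\<beta> that])
      then show ?thesis using \<phi>(2) by (simp add: coupling_cost_def c_def)
    qed
    then show ?thesis
      unfolding r W[OF \<alpha>\<beta>] transport_cost_def
      using couplings_nonempty[OF \<alpha>\<beta>] by (intro cInf_greatest) auto
  qed
  have "SWD K A d r1 r2 = ereal (W r1 r2)"
    unfolding SWD_def
  proof (rule antisym)
    show "(SUP \<phi> \<in> {\<phi>. jointly_convex_on (conv K A) \<phi> \<and>
        (\<forall>k \<in> {1..K}. \<forall>l \<in> {1..K}. \<phi> (A k) (A l) = d (A k) (A l))}. ereal (\<phi> r1 r2)) \<le> ereal (W r1 r2)"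
      using maximal by (intro SUP_least) auto
  qed (intro SUP_upper CollectI conjI ballI W_convex W_vertices)
  then show ?thesis by (simp add: W_def)
qed

end
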